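(* Let $d\ge1$, $p\in(1,2]$, $\frac1p+\frac1q=1$, $\sigma>0$, $x^*\in\mathbb R^d$ and $y^*\in\mathbb R$. Let $J_p$, $\mathcal K_p$ and $\mathrm{prox}$ be as in the context, and set $$h(z):=\big(\sigma y^*+\tfrac1q z^q\big)z^{q-2}\quad(z\ge0),\qquad z_0:=-q\sigma y^*.$$ (i) It holds $$\mathrm{prox}_{\frac1\sigma J_p}(x^*,y^* )=\begin{cases}(0,0)&\text{if }(\sigma x^*,\sigma y^* )\in\mathcal K_p,\\[1ex]\Big(x^*\,\dfrac{h(\hat z)}{1+h(\hat z)},\ y^*+\dfrac1{\sigma q}\hat z^{\,q}\Big)&\text{otherwise},\end{cases}$$ where, in the second case, $\hat z\in\mathbb R_{\ge0}$ is the unique solution of the equation $$z\,(1+h(z))-\sigma|x^*|=0$$ in the interval $\big[\max(0,z_0)^{1/q},+\infty\big)$. (ii) In the case $(\sigma x^*,\sigma y^* )\notin\mathcal K_p$, Newton's method applied to the function $z\mapsto z(1+h(z))-\sigma|x^*|$ converges, for any starting point $z\ge\max(0,z_0)^{1/q}$, quadratically to the largest zero of this function.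
   Context: $|\cdot|$ is the Euclidean norm. The function $J_p:\mathbb R^d\times\mathbb R\to\mathbb R\cup\{+\infty\}$ is $J_p(x,y)=\frac1p\frac{|x|^p}{y^{p-1}}$ if $y>0$, $J_p(0,0)=0$, and $J_p(x,y)=+\infty$ otherwise. The set $\mathcal K_p$ is $$\mathcal K_p:=\{(a,b)\in\mathbb R^d\times\mathbb R:\ \tfrac1q|a|^q+b\le0\}.$$ For a proper, convex, lower semicontinuous function $\phi$ on $\mathbb R^{n}$, the proximal map is $\mathrm{prox}_{\phi}(t):=\operatorname{argmin}_{s}\{\frac12|s-t|^2+\phi(s)\}$. Since $p\in(1,2]$, one has $q\ge2$; for $q=2$ the factor $z^{q-2}$ is identically $1$.
   Formalization: In (ii) the quadratic rate is claimed only if x* ≠ 0, q = 2 or q ≥ 3; for x* = 0, y* > 0, 2 < q < 3 the largest zero is 0 and Newton's method converges only with order q−1 < 2 from every z > 0. Convergence itself is claimed in all cases. *)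

theory Defs
  imports "HOL-Analysis.Analysis"
begin

definition J :: "real \<Rightarrow> (real ^ 'n) \<times> real \<Rightarrow> ereal" where
  "J p = (\<lambda>(x, y).
     if y > 0 then ereal (1 / p * (norm x powr p / y powr (p - 1)))
     else if x = 0 \<and> y = 0 then 0
     else \<infinity>)"

text \<open>The set \<open>K\<^sub>p\<close> depends on \<open>p\<close> only through the conjugate exponent \<open>q\<close>, which is the
  argument here.\<close>

definition K :: "real \<Rightarrow> ((real ^ 'n) \<times> real) set" where
  "K q = {(a, b). 1 / q * norm a powr q + b \<le> 0}"

text \<open>The proximal map is given as the set of all minimisers over the whole space; that it is
  single-valued at \<open>t\<close> with value \<open>s\<close> reads \<open>prox \<phi> t = {s}\<close>. The norm on
  \<open>(real ^ 'n) \<times> real\<close> is the Euclidean norm of the product.\<close>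

definition prox :: "('a::euclidean_space \<Rightarrow> ereal) \<Rightarrow> 'a \<Rightarrow> 'a set" where
  "prox \<phi> t = {s. is_arg_min (\<lambda>s. ereal (1 / 2 * (norm (s - t))\<^sup>2) + \<phi> s) (\<lambda>_. True) s}"

text \<open>The case distinction is needed because \<open>0 powr 0 = 0\<close>, whereas the factor \<open>z powr (q - 2)\<close>
  has to be identically 1 for \<open>q = 2\<close>. Only arguments \<open>z \<ge> 0\<close> are meaningful.\<close>

definition h :: "real \<Rightarrow> real \<Rightarrow> real \<Rightarrow> real \<Rightarrow> real" where
  "h q \<sigma> y z = (\<sigma> * y + 1 / q * z powr q) * (if q = 2 then 1 else z powr (q - 2))"

definition z_fun :: "real \<Rightarrow> real \<Rightarrow> real ^ 'n \<Rightarrow> real \<Rightarrow> real \<Rightarrow> real" where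
  "z_fun q \<sigma> x y z = z * (1 + h q \<sigma> y z) - \<sigma> * norm x"

definition z_low :: "real \<Rightarrow> real \<Rightarrow> real \<Rightarrow> real" where
  "z_low q \<sigma> y = (max 0 (- q * \<sigma> * y)) powr (1 / q)"

text \<open>Newton's method for a function on a domain \<open>S\<close>, with derivatives taken within \<open>S\<close>
  (hence one-sided at a boundary point of an interval).\<close>

definition newton_step :: "(real \<Rightarrow> real) \<Rightarrow> real set \<Rightarrow> real \<Rightarrow> real" where
  "newton_step f S z = z - f z / vector_derivative f (at z within S)"

definition newton_iter :: "(real \<Rightarrow> real) \<Rightarrow> real set \<Rightarrow> real \<Rightarrow> nat \<Rightarrow> real" where
  "newton_iter f S w k = (newton_step f S ^^ k) w"

text \<open>Needed separately because \<open>newton_step\<close> is total: no iterate leaves the domain, fails to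
  have a derivative, or leads to a division by zero.\<close>

definition newton_well_defined :: "(real \<Rightarrow> real) \<Rightarrow> real set \<Rightarrow> real \<Rightarrow> bool" where
  "newton_well_defined f S w \<longleftrightarrow>
     (\<forall>k. newton_iter f S w k \<in> S \<and>
          f differentiable (at (newton_iter f S w k) within S) \<and>
          vector_derivative f (at (newton_iter f S w k) within S) \<noteq> 0)"

text \<open>The method for \<open>z_fun q \<sigma> x y\<close> does not converge quadratically when \<open>x = 0\<close>, \<open>y > 0\<close> and
  \<open>2 < q < 3\<close>: the limit is then 0, and near 0 the function behaves like
  \<open>z + \<sigma> * y * z powr (q - 1)\<close>, so the error is only reduced to the order \<open>q - 1 < 2\<close>.\<close>

definition converges_quadratically :: "(nat \<Rightarrow> real) \<Rightarrow> real \<Rightarrow> bool" where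
  "converges_quadratically s L \<longleftrightarrow>
     s \<longlonglongrightarrow> L \<and> (\<exists>C. \<forall>k. \<bar>s (Suc k) - L\<bar> \<le> C * \<bar>s k - L\<bar>\<^sup>2)"

definition largest_zero_on :: "(real \<Rightarrow> real) \<Rightarrow> real set \<Rightarrow> real \<Rightarrow> bool" where
  "largest_zero_on f S L \<longleftrightarrow> L \<in> S \<and> f L = 0 \<and> (\<forall>z\<in>S. f z = 0 \<longrightarrow> z \<le> L)"

end

theory Submission
  imports Defs
begin

text \<open>
  Every \<open>(a, b) \<in> K\<^sub>p\<close> is a linear minorant of \<open>J\<^sub>p\<close> by Young's inequality, and it is a
  subgradient at each point where it touches \<open>J\<^sub>p\<close>. A point \<open>s\<close> is therefore the proximal point
  of \<open>t\<close> as soon as \<open>\<sigma> (t - s)\<close> lies in \<open>K\<^sub>p\<close> and touches \<open>J\<^sub>p\<close> at \<open>s\<close>. If \<open>\<sigma> t \<in> K\<^sub>p\<close> this holds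
  for \<open>s = 0\<close>; otherwise the equation for \<open>z\<close> says that \<open>\<sigma> (t - s)\<close> is the boundary point
  \<open>(a, - |a|\<^sup>q / q)\<close> of \<open>K\<^sub>p\<close> with \<open>|a| = z\<close>. On \<open>[z_low, \<infinity>)\<close> the function of this equation is
  convex with derivative at least 1, so that from the first step on Newton's method decreases
  monotonically to the root.
\<close>

section \<open>Newton's method for increasing convex functions\<close>

text \<open>Convexity of \<open>f\<close> is encoded as monotonicity of \<open>D\<close>, and only
  from \<open>a\<close> on. The set \<open>S\<close> is kept apart from \<open>{a..}\<close> because
  derivatives are later taken within \<open>{0..}\<close>, whatever \<open>a\<close> is.\<close>

locale convex_newton =
  fixes f D :: "real \<Rightarrow> real" and S :: "real set" and a L :: real
  assumes domain: "{a..} \<subseteq> S"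
    and deriv: "\<And>w. a \<le> w \<Longrightarrow> (f has_real_derivative D w) (at w within S)"
    and D_pos: "0 < D a"
    and D_mono: "\<And>v w. a \<le> v \<Longrightarrow> v \<le> w \<Longrightarrow> D v \<le> D w"
    and root_ge: "a \<le> L"
    and root: "f L = 0"
begin

lemma mean_value:
  assumes "a \<le> v" "v \<le> w"
  obtains x where "v \<le> x" "x \<le> w" "f w - f v = D x * (w - v)"
proof -
  have "\<exists>x\<in>{v..w}. f w - f v = D x * (w - v)"
  proof (rule mvt_very_simple[OF assms(2)])
    fix x assume "v \<le> x" "x \<le> w"
    then have "(f has_real_derivative D x) (at x within {v..w})"
      using assms domain by (intro DERIV_subset[OF deriv]) auto
    then show "(f has_derivative (*) (D x)) (at x within {v..w})"
      by (simp add: has_field_derivative_def)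
  qed
  then show thesis using that by auto
qed

text \<open>The mean slope between \<open>v\<close> and \<open>w\<close> is a value of
  \<open>D\<close> between them; monotonicity compares it with \<open>D w\<close> in the direction
  that suits the sign of \<open>v - w\<close>.\<close>

lemma tangent_le:
  assumes "a \<le> v" "a \<le> w"
  shows "f w + D w * (v - w) \<le> f v"
proof (cases "v \<le> w")
  case True
  obtain x where x: "v \<le> x" "x \<le> w" "f w - f v = D x * (w - v)"
    using mean_value[OF assms(1) True] .
  have "D x * (w - v) \<le> D w * (w - v)"
    using x assms True by (intro mult_right_mono D_mono) auto
  with x(3) show ?thesis by (simp add: algebra_simps)
next
  case False
  then obtain x where x: "w \<le> x" "x \<le> v" "f v - f w = D x * (v - w)"
    using mean_value[of w v] assms by auto
  have "D w * (v - w) \<le> D x * (v - w)"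
    using x assms False by (intro mult_right_mono D_mono) auto
  with x(3) show ?thesis by (simp add: algebra_simps)
qed

lemma D_ge: "a \<le> w \<Longrightarrow> D a \<le> D w"
  by (rule D_mono) auto

lemma D_gt_0: "a \<le> w \<Longrightarrow> 0 < D w"
  using D_ge D_pos by fastforce

lemma vector_derivative_eq:
  assumes "a \<le> w"
  shows "vector_derivative f (at w within S) = D w"
proof (rule vector_derivative_within)
  \<comment> \<open>Uniqueness of the derivative within \<open>S\<close> requires a limit point of
    \<open>S\<close>; the interval to the right provides one even at a boundary point.\<close>
  have "w islimpt {w..w + 1}"
    by (simp add: islimpt_Icc)
  then have "w islimpt S"
    using assms domain by (elim islimpt_subset) auto
  then show "at w within S \<noteq> bot"
    by (simp add: trivial_limit_within)
  show "(f has_vector_derivative D w) (at w within S)"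
    using deriv[OF assms] by (simp add: has_real_derivative_iff_has_vector_derivative)
qed

lemma newton_step_eq: "a \<le> w \<Longrightarrow> newton_step f S w = w - f w / D w"
  by (simp add: newton_step_def vector_derivative_eq)

text \<open>The tangent at \<open>w\<close> lies below \<open>f\<close>, so it is nonpositive at
  \<open>L\<close> and has its zero to the right of \<open>L\<close>. A start left of the root thus
  jumps across it in one step.\<close>

lemma newton_step_ge_root:
  assumes "a \<le> w"
  shows "L \<le> newton_step f S w"
proof -
  have "f w \<le> D w * (w - L)"
    using tangent_le[OF root_ge assms] root by (simp add: algebra_simps)
  then have "f w / D w \<le> w - L"
    using D_gt_0[OF assms] by (simp add: pos_divide_le_eq mult.commute)
  then show ?thesis
    using assms by (simp add: newton_step_eq)
qed

text \<open>The tangent at the root bounds \<open>f w\<close> from below. The resulting factor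
  \<open>(D w - D L) / D w\<close> is less than 1, which gives linear contraction, and it becomes of
  order \<open>w - L\<close> once \<open>D\<close> is Lipschitz at \<open>L\<close>.\<close>

lemma newton_step_error:
  assumes "L \<le> w"
  shows "newton_step f S w - L \<le> (w - L) * (D w - D L) / D w"
proof -
  have w: "a \<le> w" using root_ge assms by (rule order_trans)
  have "D L * (w - L) \<le> f w"
    using tangent_le[OF w root_ge] root by simp
  then have "D L * (w - L) / D w \<le> f w / D w"
    using D_gt_0[OF w] by (intro divide_right_mono) auto
  moreover have "(w - L) * (D w - D L) / D w = (w - L) - D L * (w - L) / D w"
    using D_gt_0[OF w] by (simp add: field_simps)
  ultimately show ?thesis
    using w by (simp add: newton_step_eq)
qed

section \<open>Monotonicity and convergence of the Newton iterates\<close>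

lemma newton_iter_Suc: "newton_iter f S w (Suc k) = newton_step f S (newton_iter f S w k)"
  by (simp add: newton_iter_def)

lemma newton_iter_ge_start:
  assumes "a \<le> w"
  shows "a \<le> newton_iter f S w k"
proof (induction k)
  case 0
  then show ?case using assms by (simp add: newton_iter_def)
next
  case (Suc k)
  then show ?case using newton_step_ge_root root_ge by (fastforce simp: newton_iter_Suc)
qed

lemma newton_iter_ge_root: "a \<le> w \<Longrightarrow> L \<le> newton_iter f S w (Suc k)"
  using newton_step_ge_root newton_iter_ge_start by (simp add: newton_iter_Suc)

lemma newton_step_le:
  assumes "L \<le> w"
  shows "newton_step f S w \<le> w"
proof -
  have "0 \<le> D L * (w - L)" using assms D_gt_0[OF root_ge] by simp
  also have "\<dots> \<le> f w" using tangent_le[of w L] assms root root_ge by simp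
  finally have "0 \<le> f w / D w" using assms root_ge D_gt_0[of w] by simp
  then show ?thesis using assms root_ge by (simp add: newton_step_eq)
qed

text \<open>The shift by one matters: from a start left of the root the first step goes up.\<close>

lemma newton_iter_decseq:
  assumes "a \<le> w"
  shows "decseq (\<lambda>k. newton_iter f S w (Suc k))"
  using newton_step_le newton_iter_ge_root[OF assms] newton_iter_Suc
  by (intro decseq_SucI) metis

lemma newton_well_defined:
  assumes "a \<le> w"
  shows "newton_well_defined f S w"
  unfolding newton_well_defined_def
proof (intro allI conjI)
  fix k
  have ge: "a \<le> newton_iter f S w k" using newton_iter_ge_start[OF assms] .
  show "newton_iter f S w k \<in> S" using ge domain by auto
  show "f differentiable at (newton_iter f S w k) within S"
    using deriv[OF ge] real_differentiable_def by blast
  show "vector_derivative f (at (newton_iter f S w k) within S) \<noteq> 0"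
    using D_gt_0[OF ge] by (simp add: vector_derivative_eq[OF ge])
qed

lemma newton_iter_tendsto:
  assumes "a \<le> w"
  shows "newton_iter f S w \<longlonglongrightarrow> L"
proof -
  define s where "s = (\<lambda>k. newton_iter f S w (Suc k))"
  have dec: "decseq s" and ge: "\<And>k. L \<le> s k"
    using newton_iter_decseq[OF assms] newton_iter_ge_root[OF assms] by (auto simp: s_def)
  \<comment> \<open>A step from \<open>w\<close> contracts the error by
    \<open>1 - D L / D w\<close>. As the iterates decrease and \<open>D\<close> is monotone, this
    factor is worst at \<open>s 0\<close>, so one \<open>\<rho>\<close> serves for all
    steps.\<close>
  define \<rho> where "\<rho> = 1 - D L / D (s 0)"
  have D0: "0 < D L" "0 < D (s 0)" "D L \<le> D (s 0)"
    using root_ge ge[of 0] by (auto intro: D_gt_0 D_mono)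
  have \<rho>: "0 \<le> \<rho>" "\<rho> < 1" using D0 by (auto simp: \<rho>_def)
  have step: "s (Suc k) - L \<le> \<rho> * (s k - L)" for k
  proof -
    have k: "L \<le> s k" "s k \<le> s 0" using ge dec by (auto simp: decseq_def)
    have D: "0 < D (s k)" "D (s k) \<le> D (s 0)" using k root_ge by (auto intro: D_gt_0 D_mono)
    have "s (Suc k) - L \<le> (s k - L) * (D (s k) - D L) / D (s k)"
      using newton_step_error[OF k(1)] by (simp add: s_def newton_iter_Suc)
    also have "\<dots> = (s k - L) * (1 - D L / D (s k))"
      using D by (simp add: field_simps)
    also have "\<dots> \<le> (s k - L) * \<rho>"
      using k D D0 unfolding \<rho>_def by (intro mult_left_mono diff_left_mono divide_left_mono) auto
    finally show ?thesis by (simp add: mult.commute)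
  qed
  have bound: "s k - L \<le> \<rho> ^ k * (s 0 - L)" for k
  proof (induction k)
    case (Suc k)
    have "\<rho> * (s k - L) \<le> \<rho> * (\<rho> ^ k * (s 0 - L))"
      using Suc \<rho> by (intro mult_left_mono) auto
    with step[of k] show ?case by (simp add: mult.assoc)
  qed simp
  have "(\<lambda>k. s k - L) \<longlonglongrightarrow> 0"
  proof (rule tendsto_sandwich)
    show "\<forall>\<^sub>F k in sequentially. 0 \<le> s k - L"
      "\<forall>\<^sub>F k in sequentially. s k - L \<le> \<rho> ^ k * (s 0 - L)"
      using ge bound by auto
    show "(\<lambda>k. \<rho> ^ k * (s 0 - L)) \<longlonglongrightarrow> 0"
      using \<rho> by (intro tendsto_mult_left_zero LIMSEQ_power_zero) auto
  qed simp
  then have "s \<longlonglongrightarrow> L" by (simp add: LIM_zero_iff)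
  then show ?thesis unfolding s_def by (rule LIMSEQ_imp_Suc)
qed

text \<open>In \<open>newton_step_error\<close> the Lipschitz bound turns \<open>D w - D L\<close>
  into a second factor \<open>w - L\<close>, and the denominator is at least \<open>D a\<close>. A
  constant depending on \<open>B\<close> suffices, since all iterates after the first step stay
  between \<open>L\<close> and the first of them.\<close>

lemma newton_converges_quadratically:
  assumes w: "a \<le> w"
    and lipschitz: "\<And>B. \<exists>M. \<forall>v\<in>{L..B}. D v - D L \<le> M * (v - L)"
  shows "converges_quadratically (newton_iter f S w) L"
  unfolding converges_quadratically_def
proof (intro conjI newton_iter_tendsto w)
  define s where "s = newton_iter f S w"
  have dec: "decseq (\<lambda>k. s (Suc k))" and ge: "\<And>k. L \<le> s (Suc k)"
    using newton_iter_decseq[OF w] newton_iter_ge_root[OF w] by (auto simp: s_def)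
  obtain M where M: "\<And>v. L \<le> v \<Longrightarrow> v \<le> s (Suc 0) \<Longrightarrow> D v - D L \<le> M * (v - L)"
    using lipschitz[of "s (Suc 0)"] by (meson atLeastAtMost_iff)
  \<comment> \<open>The first step may jump across the root from the left, where \<open>lipschitz\<close> says nothing;
    its error is absorbed into the constant.\<close>
  define C where "C = max (M / D a) (\<bar>s (Suc 0) - L\<bar> / \<bar>s 0 - L\<bar>\<^sup>2)"
  have "\<bar>s (Suc k) - L\<bar> \<le> C * \<bar>s k - L\<bar>\<^sup>2" for k
  proof (cases k)
    case 0
    show ?thesis
    proof (cases "s 0 = L")
      case True
      \<comment> \<open>The quotient in \<open>C\<close> is here a division by zero; the bound holds
        instead because a Newton step fixes the root.\<close>
      then have "s (Suc 0) = L"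
        using root root_ge by (simp add: s_def newton_iter_Suc newton_step_eq)
      with 0 True show ?thesis by simp
    next
      case False
      then have "\<bar>s (Suc 0) - L\<bar> = \<bar>s (Suc 0) - L\<bar> / \<bar>s 0 - L\<bar>\<^sup>2 * \<bar>s 0 - L\<bar>\<^sup>2"
        by simp
      also have "\<dots> \<le> C * \<bar>s 0 - L\<bar>\<^sup>2"
        unfolding C_def by (intro mult_right_mono) auto
      finally show ?thesis using 0 by simp
    qed
  next
    case (Suc j)
    have k: "L \<le> s k" "s k \<le> s (Suc 0)"
      using Suc ge[of j] decseqD[OF dec, of 0 j] by auto
    have Dk: "0 < D (s k)" "D a \<le> D (s k)" "D L \<le> D (s k)"
      using k root_ge by (auto intro: D_gt_0 D_ge D_mono)
    have "\<bar>s (Suc k) - L\<bar> = s (Suc k) - L" using ge[of k] by simp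
    also have "\<dots> \<le> (s k - L) * (D (s k) - D L) / D (s k)"
      using newton_step_error[OF k(1)] by (simp add: s_def newton_iter_Suc)
    also have "\<dots> \<le> (s k - L) * (D (s k) - D L) / D a"
      using k Dk D_pos by (intro divide_left_mono mult_nonneg_nonneg) auto
    also have "\<dots> \<le> (s k - L) * (M * (s k - L)) / D a"
      using k M[OF k] D_pos by (intro divide_right_mono mult_left_mono) auto
    also have "\<dots> = M / D a * \<bar>s k - L\<bar>\<^sup>2"
      by (simp add: power2_eq_square)
    also have "\<dots> \<le> C * \<bar>s k - L\<bar>\<^sup>2"
      unfolding C_def by (intro mult_right_mono) auto
    finally show ?thesis .
  qed
  then show "\<exists>C. \<forall>k. \<bar>newton_iter f S w (Suc k) - L\<bar> \<le> C * \<bar>newton_iter f S w k - L\<bar>\<^sup>2"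
    unfolding s_def by blast
qed

end

section \<open>The function whose root is sought\<close>

lemma has_real_derivative_powr_within_nonneg:
  assumes "1 \<le> s" "0 \<le> z"
  shows "((\<lambda>x. x powr s) has_real_derivative s * (if s = 1 then 1 else z powr (s - 1)))
    (at z within {0..})"
proof -
  \<comment> \<open>The standard rule covers \<open>0 < z\<close>. At 0 the exponent 1 is separated
    because \<open>0 powr 0 = 0\<close>.\<close>
  consider "0 < z" | "z = 0" "s = 1" | "z = 0" "1 < s" using assms by fastforce
  then show ?thesis
  proof cases
    case 1
    then show ?thesis
      using has_real_derivative_powr[of z s] by (auto intro: has_field_derivative_at_within)
  next
    case 2
    have "((\<lambda>x. x) has_real_derivative 1) (at z within {0..})" by simp
    then have "((\<lambda>x. x powr 1) has_real_derivative 1) (at z within {0..})"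
      by (rule has_field_derivative_transform_within[where d = 1]) (use assms in auto)
    with 2 show ?thesis by simp
  next
    case 3
    have "continuous_on {0..} (\<lambda>x::real. x powr (s - 1))"
      using 3 by (intro continuous_on_powr' continuous_intros) auto
    then have "((\<lambda>x. x powr (s - 1)) \<longlongrightarrow> 0) (at 0 within {0..})"
      using 3 unfolding continuous_on_def by (metis atLeast_iff order_refl powr_zero_eq_one
          diff_gt_0_iff_gt less_irrefl powr_eq_0_iff)
    \<comment> \<open>The difference quotient at 0 is itself the power
      \<open>x powr (s - 1)\<close>.\<close>
    then have "((\<lambda>x. (x powr s - 0 powr s) / (x - 0)) \<longlongrightarrow> 0) (at 0 within {0..})"
    proof (rule Lim_transform_eventually)
      show "\<forall>\<^sub>F x in at 0 within {0..}. x powr (s - 1) = (x powr s - 0 powr s) / (x - 0)"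
        by (auto simp: eventually_at_filter powr_diff)
    qed
    with 3 show ?thesis by (simp add: has_field_derivative_iff)
  qed
qed

lemma powr_lipschitz:
  fixes L B s :: real
  assumes "0 \<le> s" "0 \<le> L" "0 < L \<or> 1 \<le> s"
  shows "\<exists>M. \<forall>v\<in>{L..B}. \<bar>v powr s - L powr s\<bar> \<le> M * (v - L)"
proof (intro exI ballI)
  fix v assume v: "v \<in> {L..B}"
  \<comment> \<open>The power \<open>x powr (s - 1)\<close> in the derivative is nondecreasing for
    \<open>1 \<le> s\<close> and nonincreasing otherwise; the sum of its end values bounds it in
    both cases.\<close>
  show "\<bar>v powr s - L powr s\<bar> \<le> (s * (L powr (s - 1) + B powr (s - 1))) * (v - L)"
  proof (cases "v = L")
    case False
    with v have "L < v" by simp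
    moreover have "continuous_on {L..v} (\<lambda>x. x powr s)"
      using assms by (intro continuous_on_powr' continuous_intros) auto
    moreover have "((\<lambda>x. x powr s) has_derivative (*) (s * x powr (s - 1))) (at x)"
      if "L < x" "x < v" for x
      using has_real_derivative_powr[of x s] that assms by (simp add: has_field_derivative_def)
    ultimately obtain x where x: "L < x" "x < v"
      "v powr s - L powr s = s * x powr (s - 1) * (v - L)"
      using mvt[of L v "\<lambda>x. x powr s" "\<lambda>x. (*) (s * x powr (s - 1))"] by metis
    have "x powr (s - 1) \<le> L powr (s - 1) + B powr (s - 1)"
    proof (cases "1 \<le> s")
      case True
      then have "x powr (s - 1) \<le> B powr (s - 1)"
        using x v assms by (intro powr_mono2) auto
      then show ?thesis using powr_ge_zero[of L "s - 1"] by linarith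
    next
      case False
      then have "x powr (s - 1) \<le> L powr (s - 1)"
        using x v assms by (intro powr_mono2') auto
      then show ?thesis using powr_ge_zero[of B "s - 1"] by linarith
    qed
    then have "s * x powr (s - 1) * (v - L) \<le> s * (L powr (s - 1) + B powr (s - 1)) * (v - L)"
      using assms x by (intro mult_right_mono mult_left_mono) auto
    moreover have "0 \<le> s * x powr (s - 1) * (v - L)"
      using assms x by (intro mult_nonneg_nonneg) auto
    ultimately show ?thesis using x(3) by simp
  qed simp
qed

text \<open>This is the derivative of \<open>z_fun\<close> with \<open>c\<close> standing for
  \<open>\<sigma> * y\<close>. The conditional repeats the convention of \<open>h\<close>, so that
  the factor is 1 for \<open>q = 2\<close> even at \<open>z = 0\<close>.\<close>

definition z_deriv :: "real \<Rightarrow> real \<Rightarrow> real \<Rightarrow> real" where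
  "z_deriv q c z = 1 + c * ((q - 1) * (if q = 2 then 1 else z powr (q - 2)))
     + (2 * q - 1) / q * z powr (2 * q - 2)"

text \<open>The outer factor \<open>z\<close> raises the exponent \<open>q - 2\<close> to
  \<open>q - 1\<close>, which is at least 1, so the case distinction on \<open>q = 2\<close>
  disappears.\<close>

lemma z_fun_eq:
  assumes "2 \<le> q" "0 \<le> z"
  shows "z_fun q \<sigma> x y z =
    z + \<sigma> * y * z powr (q - 1) + 1 / q * z powr (2 * q - 1) - \<sigma> * norm x"
proof (cases "z = 0")
  case False
  with assms have z: "0 < z" by simp
  have 1: "z * (if q = 2 then 1 else z powr (q - 2)) = z powr (q - 1)"
    using z by (auto simp: powr_mult_base)
  have 2: "z powr (q * 2 - 1) = z powr q * z powr (q - 1)"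
    by (simp add: powr_add[symmetric] mult.commute)
  have "z * (1 + h q \<sigma> y z) =
      z + (\<sigma> * y + 1 / q * z powr q) * (z * (if q = 2 then 1 else z powr (q - 2)))"
    unfolding h_def by (simp only: algebra_simps)
  then show ?thesis
    unfolding z_fun_def 1 by (simp add: 2 mult.commute[of 2] distrib_left distrib_right)
qed (simp add: z_fun_def)

lemma z_fun_has_real_derivative:
  assumes "2 \<le> q" "0 \<le> z"
  shows "(z_fun q \<sigma> x y has_real_derivative z_deriv q (\<sigma> * y) z) (at z within {0..})"
proof -
  have d1: "((\<lambda>z. z powr (q - 1)) has_real_derivative
      (q - 1) * (if q = 2 then 1 else z powr (q - 2))) (at z within {0..})"
    using has_real_derivative_powr_within_nonneg[of "q - 1" z] assms by auto
  have d2: "((\<lambda>z. z powr (2 * q - 1)) has_real_derivative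
      (2 * q - 1) * z powr (2 * q - 2)) (at z within {0..})"
    using has_real_derivative_powr_within_nonneg[of "2 * q - 1" z] assms by auto
  have "((\<lambda>z. z + \<sigma> * y * z powr (q - 1) + 1 / q * z powr (2 * q - 1) - \<sigma> * norm x)
      has_real_derivative z_deriv q (\<sigma> * y) z) (at z within {0..})"
    unfolding z_deriv_def by (rule derivative_eq_intros d1 d2 refl)+ (simp add: field_simps)
  then show ?thesis
    by (rule has_field_derivative_transform_within[where d = 1]) (use assms in \<open>auto simp: z_fun_eq\<close>)
qed

text \<open>From \<open>z_low\<close> on the first factor of \<open>h\<close> is nonnegative: for
  \<open>y \<le> 0\<close> its zero is \<open>z_low\<close>, and for \<open>y > 0\<close> it is
  positive anyway. The sign arguments for \<open>h\<close> and \<open>z_deriv\<close> rest on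
  this.\<close>

lemma z_lowD:
  assumes "0 < q" "z_low q \<sigma> y \<le> z"
  shows "0 \<le> z" "0 \<le> \<sigma> * y + 1 / q * z powr q"
proof -
  show z: "0 \<le> z" using assms(2) powr_ge_zero order_trans unfolding z_low_def by blast
  have "max 0 (- q * \<sigma> * y) = z_low q \<sigma> y powr q"
    using assms(1) by (simp add: z_low_def powr_powr)
  also have "\<dots> \<le> z powr q"
    using assms by (intro powr_mono2) (auto simp: z_low_def)
  finally show "0 \<le> \<sigma> * y + 1 / q * z powr q"
    using assms(1) by (simp add: field_simps)
qed

lemma h_nonneg:
  assumes "0 < q" "z_low q \<sigma> y \<le> z"
  shows "0 \<le> h q \<sigma> y z"
  using z_lowD(2)[OF assms] by (auto simp: h_def intro: mult_nonneg_nonneg)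

lemma z_deriv_ge_1:
  assumes q: "2 \<le> q" and z: "z_low q \<sigma> y \<le> z"
  shows "1 \<le> z_deriv q (\<sigma> * y) z"
proof -
  have z0: "0 \<le> z" "0 \<le> \<sigma> * y + 1 / q * z powr q"
    using z_lowD[OF _ z] q by auto
  define g where "g = (if q = 2 then 1 else z powr (q - 2))"
  have g: "0 \<le> g" by (simp add: g_def)
  have e: "z powr (2 * q - 2) = z powr q * g"
    using q z0 by (auto simp: g_def powr_add[symmetric])
  \<comment> \<open>Writing \<open>(2 * q - 1) / q\<close> as \<open>(q - 1) / q + 1\<close>
    completes the nonnegative first factor of \<open>h\<close>.\<close>
  have "z_deriv q (\<sigma> * y) z = 1 + (q - 1) * g * (\<sigma> * y + 1 / q * z powr q) + z powr q * g"
    unfolding z_deriv_def g_def[symmetric] e using q by (simp add: field_simps)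
  moreover have "0 \<le> (q - 1) * g * (\<sigma> * y + 1 / q * z powr q)" "0 \<le> z powr q * g"
    using q g z0 by auto
  ultimately show ?thesis by linarith
qed

text \<open>The sign of the second derivative is checked only in the interior, where
  \<open>z > 0\<close>, because \<open>z powr (q - 3)\<close> may be singular at 0; continuity
  handles the end points.\<close>

lemma z_deriv_mono:
  assumes q: "2 \<le> q" and v: "z_low q \<sigma> y \<le> v" and "v \<le> w"
  shows "z_deriv q (\<sigma> * y) v \<le> z_deriv q (\<sigma> * y) w"
proof (rule DERIV_nonneg_imp_increasing_open[OF \<open>v \<le> w\<close>])
  have v0: "0 \<le> v" using z_lowD(1)[OF _ v] q by simp
  show "continuous_on {v..w} (z_deriv q (\<sigma> * y))"
    unfolding z_deriv_def
    by (cases "q = 2") (use v0 q in \<open>auto intro!: continuous_intros continuous_on_powr'\<close>)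
  fix z assume "v < z" "z < w"
  then have z: "0 < z" "0 \<le> \<sigma> * y + 1 / q * z powr q"
    using v0 z_lowD(2)[of q \<sigma> y z] v q by auto
  let ?d = "\<sigma> * y * ((q - 1) * ((q - 2) * z powr (q - 3)))
    + (2 * q - 1) / q * ((2 * q - 2) * z powr (2 * q - 3))"
  have e: "z powr (2 * q - 3) = z powr q * z powr (q - 3)"
    by (simp add: powr_add[symmetric])
  \<comment> \<open>The coefficient \<open>(2 * q - 1) * (2 * q - 2) / q\<close> splits into
    \<open>(q - 1) * (q - 2) / q\<close> and \<open>3 * (q - 1)\<close>; the first part completes
    the factor known to be nonnegative.\<close>
  have "?d = (q - 1) * z powr (q - 3) * ((q - 2) * (\<sigma> * y + 1 / q * z powr q) + 3 * z powr q)"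
    unfolding e using q by (simp add: field_simps)
  also have "\<dots> \<ge> 0"
    using mult_nonneg_nonneg[OF _ z(2), of "q - 2"] q
    by (intro mult_nonneg_nonneg[of "_ * _"] add_nonneg_nonneg) simp_all
  finally have "0 \<le> ?d" .
  have d1: "((\<lambda>z. if q = 2 then 1 else z powr (q - 2)) has_real_derivative
      (q - 2) * z powr (q - 3)) (at z)"
    using has_real_derivative_powr[OF z(1), of "q - 2"] by (cases "q = 2") auto
  have d2: "((\<lambda>z. z powr (2 * q - 2)) has_real_derivative
      (2 * q - 2) * z powr (2 * q - 3)) (at z)"
    using has_real_derivative_powr[OF z(1), of "2 * q - 2"] by simp
  have "(z_deriv q (\<sigma> * y) has_real_derivative ?d) (at z)"
    unfolding z_deriv_def by (rule derivative_eq_intros d1 d2 refl)+ simp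
  with \<open>0 \<le> ?d\<close> show "\<exists>d. (z_deriv q (\<sigma> * y) has_real_derivative d) (at z) \<and> 0 \<le> d"
    by blast
qed

text \<open>The critical term is \<open>z powr (q - 2)\<close>: for \<open>2 < q < 3\<close> its
  slope blows up at 0, so in that range \<open>L\<close> must be positive.\<close>

lemma z_deriv_lipschitz:
  assumes q: "2 \<le> q" and L: "0 \<le> L" "0 < L \<or> q = 2 \<or> 3 \<le> q"
  shows "\<exists>M. \<forall>v\<in>{L..B}. z_deriv q c v - z_deriv q c L \<le> M * (v - L)"
proof -
  define g where "g = (\<lambda>z. if q = 2 then 1 else z powr (q - 2))"
  have "\<exists>M. \<forall>v\<in>{L..B}. \<bar>g v - g L\<bar> \<le> M * (v - L)"
  proof (cases "q = 2")
    case True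
    then show ?thesis by (intro exI[of _ 0]) (simp add: g_def)
  next
    case False
    then show ?thesis
      using q L powr_lipschitz[of "q - 2" L B] by (auto simp: g_def)
  qed
  then obtain M1 where M1: "\<And>v. v \<in> {L..B} \<Longrightarrow> \<bar>g v - g L\<bar> \<le> M1 * (v - L)" by blast
  obtain M2 where
    M2: "\<And>v. v \<in> {L..B} \<Longrightarrow> \<bar>v powr (2 * q - 2) - L powr (2 * q - 2)\<bar> \<le> M2 * (v - L)"
    using q L powr_lipschitz[of "2 * q - 2" L B] by fastforce
  show ?thesis
  proof (intro exI ballI)
    fix v assume v: "v \<in> {L..B}"
    have "z_deriv q c v - z_deriv q c L = c * (q - 1) * (g v - g L)
        + (2 * q - 1) / q * (v powr (2 * q - 2) - L powr (2 * q - 2))"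
      unfolding z_deriv_def g_def by (simp only: algebra_simps)
    also have "c * (q - 1) * (g v - g L) \<le> \<bar>c * (q - 1)\<bar> * \<bar>g v - g L\<bar>"
      by (metis abs_ge_self abs_mult)
    also have "\<dots> \<le> \<bar>c * (q - 1)\<bar> * (M1 * (v - L))"
      using M1[OF v] by (intro mult_left_mono) auto
    also have "(2 * q - 1) / q * (v powr (2 * q - 2) - L powr (2 * q - 2))
        \<le> (2 * q - 1) / q * (M2 * (v - L))"
      using M2[OF v] q by (intro mult_left_mono) auto
    finally show "z_deriv q c v - z_deriv q c L
        \<le> (\<bar>c * (q - 1)\<bar> * M1 + (2 * q - 1) / q * M2) * (v - L)"
      by (simp add: algebra_simps)
  qed
qed

text \<open>Intermediate values on the interval from \<open>z_low\<close> to
  \<open>\<sigma> * norm x\<close>, whose order follows from \<open>notin\<close>. At the left end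
  \<open>z * h\<close> vanishes, and at the right end only the nonnegative \<open>z * h\<close>
  remains.\<close>

lemma ex_root:
  assumes q: "2 \<le> q" and \<sigma>: "0 < \<sigma>" and notin: "(\<sigma> *\<^sub>R x, \<sigma> * y) \<notin> K q"
  obtains L where "z_low q \<sigma> y \<le> L" "z_fun q \<sigma> x y L = 0"
proof -
  define r where "r = \<sigma> * norm x"
  have r0: "0 \<le> r" using \<sigma> by (simp add: r_def)
  have "0 < 1 / q * r powr q + \<sigma> * y"
    using notin \<sigma> by (auto simp: K_def r_def)
  then have "- q * \<sigma> * y < r powr q" using q by (simp add: field_simps)
  then have "z_low q \<sigma> y \<le> (r powr q) powr (1 / q)"
    unfolding z_low_def using q by (intro powr_mono2) auto
  then have low: "z_low q \<sigma> y \<le> r" using q r0 by (simp add: powr_powr)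
  have "z_fun q \<sigma> x y (z_low q \<sigma> y) \<le> 0"
  proof (cases "0 \<le> \<sigma> * y")
    case True
    then have "max 0 (- q * \<sigma> * y) = 0" using q by (simp add: mult.assoc)
    then have "z_low q \<sigma> y = 0" by (simp add: z_low_def)
    then show ?thesis using r0 by (simp add: z_fun_def r_def)
  next
    case False
    then have "z_low q \<sigma> y powr q = - q * \<sigma> * y"
      using q by (simp add: z_low_def powr_powr mult.assoc mult_nonneg_nonpos)
    then have "h q \<sigma> y (z_low q \<sigma> y) = 0" using q by (simp add: h_def)
    then show ?thesis using low by (simp add: z_fun_def r_def)
  qed
  moreover have "0 \<le> z_fun q \<sigma> x y r"
    using h_nonneg[OF _ low] q r0 mult_nonneg_nonneg[OF r0, of "h q \<sigma> y r"]
    by (simp add: z_fun_def r_def[symmetric] distrib_left)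
  moreover have "continuous_on {z_low q \<sigma> y..r} (z_fun q \<sigma> x y)"
  proof (rule continuous_on_subset)
    show "continuous_on {0..} (z_fun q \<sigma> x y)"
      using z_fun_has_real_derivative[OF q] DERIV_continuous
      by (force simp: continuous_on_eq_continuous_within)
  qed (auto simp: z_low_def intro: order_trans[OF powr_ge_zero])
  ultimately show thesis
    using IVT'[of "z_fun q \<sigma> x y" "z_low q \<sigma> y" 0 r] low that by blast
qed

lemma convex_newton_z_fun:
  assumes "2 \<le> q" "z_low q \<sigma> y \<le> L" "z_fun q \<sigma> x y L = 0"
  shows "convex_newton (z_fun q \<sigma> x y) (z_deriv q (\<sigma> * y)) {0..} (z_low q \<sigma> y) L"
proof
  show "{z_low q \<sigma> y..} \<subseteq> {0..}"
    by (auto simp: z_low_def intro: order_trans[OF powr_ge_zero])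
  show "0 < z_deriv q (\<sigma> * y) (z_low q \<sigma> y)"
    using z_deriv_ge_1[of q \<sigma> y "z_low q \<sigma> y"] assms by simp
  show "(z_fun q \<sigma> x y has_real_derivative z_deriv q (\<sigma> * y) w) (at w within {0..})"
    if "z_low q \<sigma> y \<le> w" for w
    using z_fun_has_real_derivative z_lowD(1)[OF _ that] assms by simp
qed (use assms z_deriv_mono in auto)

lemma z_fun_root_unique:
  assumes "2 \<le> q" "z_low q \<sigma> y \<le> L" "z_fun q \<sigma> x y L = 0"
    "z_low q \<sigma> y \<le> z" "z_fun q \<sigma> x y z = 0"
  shows "z = L"
proof -
  \<comment> \<open>The tangent at the root \<open>w\<close> has positive slope and lies below
    \<open>f\<close>, so no root exceeds \<open>w\<close>; exchanging the two roots gives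
    equality.\<close>
  have "v \<le> w" if v: "z_low q \<sigma> y \<le> v" "z_fun q \<sigma> x y v = 0"
    and w: "z_low q \<sigma> y \<le> w" "z_fun q \<sigma> x y w = 0" for v w
  proof -
    interpret convex_newton "z_fun q \<sigma> x y" "z_deriv q (\<sigma> * y)" "{0..}" "z_low q \<sigma> y" w
      using convex_newton_z_fun assms(1) w by blast
    show ?thesis
      using tangent_le[OF v(1) w(1)] D_gt_0[OF w(1)] v(2) w(2) by (simp add: mult_le_0_iff)
  qed
  with assms show ?thesis by (meson order_antisym)
qed

section \<open>The proximal map\<close>

text \<open>The hypotheses say that \<open>t - u\<close> is a subgradient of \<open>\<phi>\<close>
  at \<open>u\<close>. The quadratic term then leaves a surplus of half the squared distance to
  \<open>u\<close>, which yields both minimality and uniqueness.\<close>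

lemma prox_eq_singletonI:
  fixes \<phi> :: "'a::euclidean_space \<Rightarrow> ereal"
  assumes touch: "\<phi> u = ereal m"
    and subgradient: "\<And>s. ereal (m + (t - u) \<bullet> (s - u)) \<le> \<phi> s"
  shows "prox \<phi> t = {u}"
proof -
  define G where "G = (\<lambda>s. ereal (1 / 2 * (norm (s - t))\<^sup>2) + \<phi> s)"
  have Gu: "G u = ereal (1 / 2 * (norm (u - t))\<^sup>2 + m)"
    by (simp add: G_def touch)
  have G_ge: "ereal (1 / 2 * (norm (u - t))\<^sup>2 + m + 1 / 2 * (norm (s - u))\<^sup>2) \<le> G s" for s
  proof -
    have "1 / 2 * (norm (u - t))\<^sup>2 + m + 1 / 2 * (norm (s - u))\<^sup>2
        = 1 / 2 * (norm (s - t))\<^sup>2 + (m + (t - u) \<bullet> (s - u))"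
      by (simp add: power2_norm_eq_inner inner_diff_left inner_diff_right inner_commute field_simps)
    also have "ereal \<dots> = ereal (1 / 2 * (norm (s - t))\<^sup>2) + ereal (m + (t - u) \<bullet> (s - u))"
      by simp
    also have "\<dots> \<le> G s"
      unfolding G_def by (intro add_left_mono subgradient)
    finally show ?thesis .
  qed
  have "G u \<le> G s" for s
    using G_ge[of s] unfolding Gu by (rule order_trans[rotated]) simp
  moreover have "G u < G s" if "s \<noteq> u" for s
    using G_ge[of s] unfolding Gu by (rule less_le_trans[rotated]) (use that in simp)
  ultimately have "(\<forall>y. \<not> G y < G s) \<longleftrightarrow> s = u" for s
    by (metis not_less)
  then show ?thesis
    unfolding prox_def is_arg_min_def G_def[symmetric] by simp
qed

text \<open>For \<open>y > 0\<close>, \<open>J p\<close> is the perspective of the function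
  \<open>norm x powr p / p\<close>; so Young's inequality is applied to \<open>norm x / y\<close>
  and \<open>norm a\<close> and then multiplied by \<open>y\<close>.\<close>

lemma J_ge_of_mem_K:
  fixes a x :: "real ^ 'n"
  assumes pq: "1 < p" "1 < q" "1 / p + 1 / q = 1" and ab: "(a, b) \<in> K q"
  shows "ereal (a \<bullet> x + b * y) \<le> J p (x, y)"
proof (cases "0 < y")
  case True
  have b: "b \<le> - (norm a powr q / q)" using ab by (simp add: K_def)
  have "a \<bullet> x \<le> y * (norm x / y * norm a)"
    using True norm_cauchy_schwarz[of a x] by (simp add: mult.commute)
  also have "\<dots> \<le> y * ((norm x / y) powr p / p + norm a powr q / q)"
    using True pq by (intro mult_left_mono Youngs_inequality) auto
  also have "\<dots> = 1 / p * (norm x powr p / y powr (p - 1)) + y * (norm a powr q / q)"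
    using True by (simp add: powr_divide powr_diff field_simps)
  also have "y * (norm a powr q / q) \<le> y * (- b)"
    using True b by (intro mult_left_mono) auto
  finally show ?thesis
    using True by (simp add: J_def algebra_simps)
qed (auto simp: J_def)

lemma prox_J_eqI:
  fixes a x xstar :: "real ^ 'n"
  assumes pq: "1 < p" "1 < q" "1 / p + 1 / q = 1" and \<sigma>: "0 < \<sigma>"
    and mem: "(\<sigma> *\<^sub>R (xstar - x), \<sigma> * (ystar - y)) \<in> K q"
    and touch: "J p (x, y) = ereal (\<sigma> * ((xstar - x) \<bullet> x + (ystar - y) * y))"
  shows "prox (\<lambda>s. ereal (1 / \<sigma>) * J p s) (xstar, ystar) = {(x, y)}"
proof (rule prox_eq_singletonI)
  show "ereal (1 / \<sigma>) * J p (x, y) = ereal ((xstar - x) \<bullet> x + (ystar - y) * y)"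
    using \<sigma> by (simp add: touch)
  fix s :: "(real ^ 'n) \<times> real"
  obtain x' y' where s: "s = (x', y')" by (cases s)
  \<comment> \<open>By \<open>touch\<close> the constant is the value of the linear form at
    \<open>(x, y)\<close>, so the affine minorant is linear and \<open>J_ge_of_mem_K\<close> applies
    after scaling by \<open>\<sigma>\<close>.\<close>
  have "ereal ((xstar - x) \<bullet> x + (ystar - y) * y + ((xstar, ystar) - (x, y)) \<bullet> (s - (x, y)))
      = ereal (1 / \<sigma>) * ereal (\<sigma> *\<^sub>R (xstar - x) \<bullet> x' + \<sigma> * (ystar - y) * y')"
    using \<sigma> by (simp add: s inner_diff_right distrib_left[symmetric] mult.assoc
        flip: scaleR_right_diff_distrib)
  also have "\<dots> \<le> ereal (1 / \<sigma>) * J p (x', y')"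
    using \<sigma> by (intro ereal_mult_left_mono J_ge_of_mem_K[OF pq mem]) auto
  finally show "ereal ((xstar - x) \<bullet> x + (ystar - y) * y
      + ((xstar, ystar) - (x, y)) \<bullet> (s - (x, y))) \<le> ereal (1 / \<sigma>) * J p s"
    by (simp add: s)
qed

section \<open>The two cases of the formula for the proximal point\<close>

lemma prox_J_of_mem_K:
  fixes xstar :: "real ^ 'n"
  assumes "1 < p" "1 < q" "1 / p + 1 / q = 1" "0 < \<sigma>" "(\<sigma> *\<^sub>R xstar, \<sigma> * ystar) \<in> K q"
  shows "prox (\<lambda>s. ereal (1 / \<sigma>) * J p s) (xstar, ystar) = {(0, 0)}"
  using assms by (intro prox_J_eqI[of p q]) (auto simp: J_def zero_ereal_def)

lemma prox_J_of_notin_K: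
  fixes xstar :: "real ^ 'n"
  assumes pq: "1 < p" "2 \<le> q" "1 / p + 1 / q = 1" and \<sigma>: "0 < \<sigma>"
    and notin: "(\<sigma> *\<^sub>R xstar, \<sigma> * ystar) \<notin> K q"
    and z: "z_low q \<sigma> ystar \<le> z" "z_fun q \<sigma> xstar ystar z = 0"
  shows "prox (\<lambda>s. ereal (1 / \<sigma>) * J p s) (xstar, ystar) =
    {((h q \<sigma> ystar z / (1 + h q \<sigma> ystar z)) *\<^sub>R xstar, ystar + 1 / (\<sigma> * q) * z powr q)}"
proof -
  define H where "H = h q \<sigma> ystar z"
  define x where "x = (H / (1 + H)) *\<^sub>R xstar"
  define y where "y = ystar + 1 / (\<sigma> * q) * z powr q"
  have z0: "0 \<le> z" and c0: "0 \<le> \<sigma> * ystar + 1 / q * z powr q"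
    using z_lowD[OF _ z(1)] pq by auto
  have H: "0 \<le> H" using h_nonneg[OF _ z(1)] pq by (simp add: H_def)
  have zH: "\<sigma> * norm xstar = z * (1 + H)" using z(2) by (simp add: z_fun_def H_def)
  have \<sigma>y: "\<sigma> * y = \<sigma> * ystar + 1 / q * z powr q" using \<sigma> by (simp add: y_def field_simps)
  \<comment> \<open>If \<open>y\<close> were 0, then \<open>H = 0\<close> and the equation would
    give \<open>z = \<sigma> * norm xstar\<close>, placing the scaled point on the boundary of
    \<open>K q\<close>.\<close>
  have "\<sigma> * y \<noteq> 0"
  proof
    assume y0: "\<sigma> * y = 0"
    then have "H = 0" using \<sigma>y by (simp add: H_def h_def)
    then show False using notin y0 \<sigma>y zH \<sigma> by (simp add: K_def)
  qed
  then have y: "0 < y" using c0 \<sigma>y \<sigma> by (metis less_eq_real_def zero_less_mult_pos)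
  have dx: "\<sigma> *\<^sub>R (xstar - x) = (\<sigma> / (1 + H)) *\<^sub>R xstar"
    using H by (simp add: x_def algebra_simps add_divide_distrib[symmetric]
        flip: scaleR_add_left) (simp add: field_simps flip: scaleR_left_diff_distrib)
  have norm_dx: "norm (\<sigma> *\<^sub>R (xstar - x)) = z"
    unfolding dx using H \<sigma> zH by (simp add: field_simps)
  \<comment> \<open>This is the equality case of Young's inequality for \<open>norm x / y\<close>
    and \<open>z\<close>. It holds because \<open>\<sigma> * y\<close> is the first factor of
    \<open>H\<close>.\<close>
  have norm_x: "norm x = y * z powr (q - 1)"
  proof -
    have "\<sigma> * norm x = H * z"
      using H zH by (simp add: x_def field_simps)
    also have "\<dots> = \<sigma> * y * z powr (q - 1)"
      using z0 pq by (cases "z = 0") (auto simp: H_def h_def \<sigma>y powr_mult_base mult.commute)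
    finally show ?thesis using \<sigma> by simp
  qed
  have inner_dx: "\<sigma> * ((xstar - x) \<bullet> x) = y * z powr q"
  proof -
    have "\<sigma> * ((xstar - x) \<bullet> x) = (\<sigma> *\<^sub>R (xstar - x)) \<bullet> x" by simp
    \<comment> \<open>Both vectors are nonnegative multiples of \<open>xstar\<close>, so
      Cauchy-Schwarz is an equality.\<close>
    also have "\<dots> = norm (\<sigma> *\<^sub>R (xstar - x)) * norm x"
      unfolding dx unfolding x_def using \<sigma> H by (simp add: dot_square_norm power2_eq_square)
    also have "\<dots> = y * z powr q"
      unfolding norm_dx norm_x using z0 powr_mult_base[of z "q - 1"] by simp
    finally show ?thesis .
  qed
  have dy: "\<sigma> * (ystar - y) = - (1 / q * z powr q)"
    using \<sigma>y by (simp add: right_diff_distrib)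
  have "(q - 1) * p = q" using pq by (simp add: field_simps)
  then have "norm x powr p = y powr p * z powr q"
    unfolding norm_x using y by (simp add: powr_mult powr_powr)
  then have "J p (x, y) = ereal (1 / p * (y * z powr q))"
    using y by (simp add: J_def powr_diff field_simps)
  also have "1 / p = 1 - 1 / q" using pq(3) by simp
  also have "(1 - 1 / q) * (y * z powr q) = y * z powr q - 1 / q * z powr q * y"
    by (simp add: left_diff_distrib)
  also have "\<dots> = \<sigma> * ((xstar - x) \<bullet> x) + \<sigma> * (ystar - y) * y"
    unfolding inner_dx dy by simp
  finally have touch: "J p (x, y) = ereal (\<sigma> * ((xstar - x) \<bullet> x + (ystar - y) * y))"
    by (simp only: distrib_left mult.assoc)
  have mem: "(\<sigma> *\<^sub>R (xstar - x), \<sigma> * (ystar - y)) \<in> K q"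
    unfolding K_def using norm_dx dy by simp
  show ?thesis
    using prox_J_eqI[OF _ _ _ \<sigma> mem touch] pq by (simp add: x_def y_def H_def)
qed

theorem proposition8:
  fixes p q \<sigma> ystar :: real and xstar :: "real ^ 'n"
  assumes "1 < p" and "p \<le> 2" and "1 / p + 1 / q = 1" and "0 < \<sigma>"
  shows
    "((\<sigma> *\<^sub>R xstar, \<sigma> * ystar) \<in> K q \<longrightarrow>
        prox (\<lambda>s. ereal (1 / \<sigma>) * J p s) (xstar, ystar) = {(0, 0)}) \<and>
     ((\<sigma> *\<^sub>R xstar, \<sigma> * ystar) \<notin> K q \<longrightarrow>
        (\<exists>!z. z \<in> {z_low q \<sigma> ystar..} \<and> z_fun q \<sigma> xstar ystar z = 0) \<and>
        (\<forall>z. z \<in> {z_low q \<sigma> ystar..} \<and> z_fun q \<sigma> xstar ystar z = 0 \<longrightarrow>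
           prox (\<lambda>s. ereal (1 / \<sigma>) * J p s) (xstar, ystar) =
             {((h q \<sigma> ystar z / (1 + h q \<sigma> ystar z)) *\<^sub>R xstar,
               ystar + 1 / (\<sigma> * q) * z powr q)})) \<and>
     ((\<sigma> *\<^sub>R xstar, \<sigma> * ystar) \<notin> K q \<longrightarrow>
        (\<exists>L. largest_zero_on (z_fun q \<sigma> xstar ystar) {0..} L \<and>
          (\<forall>w \<ge> z_low q \<sigma> ystar.
             newton_well_defined (z_fun q \<sigma> xstar ystar) {0..} w \<and>
             newton_iter (z_fun q \<sigma> xstar ystar) {0..} w \<longlonglongrightarrow> L \<and>
             (xstar \<noteq> 0 \<or> q = 2 \<or> 3 \<le> q \<longrightarrow>
                converges_quadratically (newton_iter (z_fun q \<sigma> xstar ystar) {0..} w) L))))"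
proof (intro conjI impI)
  have q: "2 \<le> q"
  proof -
    \<comment> \<open>Working with reciprocals also excludes \<open>q = 0\<close>, where
      \<open>1 / q\<close> would be 0 by convention.\<close>
    have "1 / q = 1 - 1 / p" using assms(3) by simp
    moreover have "1 / 2 \<le> 1 / p" "1 / p < 1" using assms(1,2) by (auto simp: field_simps)
    ultimately have "0 < 1 / q" "1 / q \<le> 1 / 2" by linarith+
    then show ?thesis by (simp add: field_simps)
  qed
  show "prox (\<lambda>s. ereal (1 / \<sigma>) * J p s) (xstar, ystar) = {(0, 0)}"
    if "(\<sigma> *\<^sub>R xstar, \<sigma> * ystar) \<in> K q"
    using prox_J_of_mem_K[OF assms(1) _ assms(3,4) that] q by simp
  assume notin: "(\<sigma> *\<^sub>R xstar, \<sigma> * ystar) \<notin> K q"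
  obtain L where L: "z_low q \<sigma> ystar \<le> L" "z_fun q \<sigma> xstar ystar L = 0"
    using ex_root[OF q assms(4) notin] .
  have L0: "0 \<le> L" using z_lowD(1)[OF _ L(1)] q by simp
  note unique = z_fun_root_unique[OF q L]
  show "\<exists>!z. z \<in> {z_low q \<sigma> ystar..} \<and> z_fun q \<sigma> xstar ystar z = 0"
    using L unique by auto
  show "\<forall>z. z \<in> {z_low q \<sigma> ystar..} \<and> z_fun q \<sigma> xstar ystar z = 0 \<longrightarrow>
      prox (\<lambda>s. ereal (1 / \<sigma>) * J p s) (xstar, ystar) =
        {((h q \<sigma> ystar z / (1 + h q \<sigma> ystar z)) *\<^sub>R xstar,
          ystar + 1 / (\<sigma> * q) * z powr q)}"
    using prox_J_of_notin_K[OF assms(1) q assms(3,4) notin] by simp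
  interpret convex_newton "z_fun q \<sigma> xstar ystar" "z_deriv q (\<sigma> * ystar)" "{0..}"
      "z_low q \<sigma> ystar" L
    using convex_newton_z_fun[OF q L] .
  \<comment> \<open>Zeros below \<open>z_low\<close> lie below \<open>L\<close>, and any other zero
    equals \<open>L\<close> by uniqueness.\<close>
  have largest: "largest_zero_on (z_fun q \<sigma> xstar ystar) {0..} L"
    unfolding largest_zero_on_def using L L0 unique by (metis atLeast_iff linear order_trans)
  have quadratic: "converges_quadratically (newton_iter (z_fun q \<sigma> xstar ystar) {0..} w) L"
    if "z_low q \<sigma> ystar \<le> w" "xstar \<noteq> 0 \<or> q = 2 \<or> 3 \<le> q" for w
  proof -
    \<comment> \<open>At 0 the function has the value \<open>- \<sigma> * norm xstar\<close>, which
      is nonzero here.\<close>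
    have "L \<noteq> 0" if "xstar \<noteq> 0"
      using L(2) assms(4) that by (auto simp: z_fun_def)
    then have "0 < L \<or> q = 2 \<or> 3 \<le> q" using L0 that(2) by auto
    then show ?thesis
      using newton_converges_quadratically[OF that(1)] z_deriv_lipschitz[OF q L0] by blast
  qed
  show "\<exists>L. largest_zero_on (z_fun q \<sigma> xstar ystar) {0..} L \<and>
      (\<forall>w \<ge> z_low q \<sigma> ystar.
         newton_well_defined (z_fun q \<sigma> xstar ystar) {0..} w \<and>
         newton_iter (z_fun q \<sigma> xstar ystar) {0..} w \<longlonglongrightarrow> L \<and>
         (xstar \<noteq> 0 \<or> q = 2 \<or> 3 \<le> q \<longrightarrow>
            converges_quadratically (newton_iter (z_fun q \<sigma> xstar ystar) {0..} w) L))"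
    using largest newton_well_defined newton_iter_tendsto quadratic by blast
qed

end
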